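(* Let $\boldsymbol k$ be a field of characteristic $0$, let $S=\boldsymbol k[x_1,\dots,x_n]$ be equipped with a Poisson bracket, $\Lambda_{ij}:=\{x_i,x_j\}$, and let $I=(f)$ be a principal Poisson ideal in $S$ with $f\neq0$. Then the Koszul complex $(K_\bullet(S,f)=S[y],\partial)$, with $y$ an odd variable, is a dg Poisson algebra. The dg Poisson structure is characterized by $\partial:y\mapsto f$, $\{x_i,x_j\}=\Lambda_{ij}$ and $\{x_i,y\}=Z_iy$, where the $Z_i\in S$ are uniquely determined up to $I$ by the requirement $\{x_i,f\}=Z_if$.
   Context: A Poisson ideal is an ideal $I$ with $\{I,S\}\subseteq I$. $S[y]=S\oplus Sy$ with $y^2=0$; viewed cohomologically, $|y|=-1$ and $\partial$ is the $S$-linear graded derivation of degree $+1$ with $\partial y=f$. A dg Poisson algebra is a graded-commutative dg algebra $(R,\partial)$ with a graded Lie bracket $\{\,,\}$ of degree $0$ that is a graded biderivation of the product and satisfies $\partial\{a,b\}=\{\partial a,b\}+(-1)^{|a|}\{a,\partial b\}$. For degree reasons $\{y,y\}=0$. *)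

theory Defs
  imports Complex_Main "HOL-Library.Poly_Mapping" "HOL-Library.Product_Plus"
begin

section \<open>Polynomial rings\<close>

text \<open>The ring \<open>k[x\<^sub>1,\<dots>,x\<^sub>n]\<close> is rendered as the monoid algebra of the exponent vectors,
  with a finite index type \<open>'n\<close> of cardinality \<open>n\<close>.\<close>

type_synonym ('n, 'k) poly_ring = "('n \<Rightarrow>\<^sub>0 nat) \<Rightarrow>\<^sub>0 'k"

definition var :: "'n \<Rightarrow> ('n, 'k::field) poly_ring" where
  "var i = Poly_Mapping.single (Poly_Mapping.single i 1) 1"

definition poly_scale :: "'k::field \<Rightarrow> ('n, 'k) poly_ring \<Rightarrow> ('n, 'k) poly_ring" where
  "poly_scale c p = Poly_Mapping.single 0 c * p"


section \<open>Poisson algebras and Poisson ideals\<close>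

locale poisson_algebra = vector_space scale
  for scale :: "'k::field \<Rightarrow> 'a::comm_ring_1 \<Rightarrow> 'a" +
  fixes bracket :: "'a \<Rightarrow> 'a \<Rightarrow> 'a"
  assumes scale_mult: "scale r (a * b) = scale r a * b"
    and bracket_linear_left: "Vector_Spaces.linear scale scale (\<lambda>a. bracket a b)"
    and bracket_linear_right: "Vector_Spaces.linear scale scale (\<lambda>b. bracket a b)"
    and bracket_self: "bracket a a = 0"
    and jacobi: "bracket a (bracket b c) + bracket b (bracket c a) + bracket c (bracket a b) = 0"
    and leibniz: "bracket a (b * c) = bracket a b * c + b * bracket a c"

definition is_ideal :: "'a::comm_ring_1 set \<Rightarrow> bool" where
  "is_ideal I \<longleftrightarrow> 0 \<in> I \<and> (\<forall>a\<in>I. \<forall>b\<in>I. a + b \<in> I) \<and> (\<forall>a\<in>I. \<forall>s. s * a \<in> I)"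

definition principal_ideal :: "'a::comm_ring_1 \<Rightarrow> 'a set" where
  "principal_ideal f = {s * f | s. True}"

definition poisson_ideal :: "('a \<Rightarrow> 'a \<Rightarrow> 'a) \<Rightarrow> 'a::comm_ring_1 set \<Rightarrow> bool" where
  "poisson_ideal bracket I \<longleftrightarrow> is_ideal I \<and> (\<forall>a\<in>I. \<forall>s. bracket a s \<in> I)"


section \<open>dg Poisson algebras\<close>

text \<open>\<open>sgn_pow m x\<close> is \<open>(-1)\<^sup>m x\<close>.\<close>

definition sgn_pow :: "int \<Rightarrow> 'r::ab_group_add \<Rightarrow> 'r" where
  "sgn_pow m x = (if even m then x else - x)"

text \<open>Gradings are cohomological and indexed by all integers. The multiplication is an explicit
  parameter, so that the underlying type only has to carry the additive group.\<close>

locale graded_commutative_algebra = vector_space scale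
  for scale :: "'k::field \<Rightarrow> 'r::ab_group_add \<Rightarrow> 'r" +
  fixes mult :: "'r \<Rightarrow> 'r \<Rightarrow> 'r"
    and unit :: 'r
    and grade :: "int \<Rightarrow> 'r set"
  assumes mult_linear_left: "Vector_Spaces.linear scale scale (\<lambda>a. mult a b)"
    and mult_linear_right: "Vector_Spaces.linear scale scale (\<lambda>b. mult a b)"
    and mult_assoc: "mult (mult a b) c = mult a (mult b c)"
    and unit_left: "mult unit a = a"
    and unit_right: "mult a unit = a"
    and grade_subspace: "subspace (grade i)"
    and grade_direct_sum:
      "\<exists>!c. (\<forall>i. c i \<in> grade i) \<and> finite {i. c i \<noteq> 0} \<and> a = (\<Sum>i | c i \<noteq> 0. c i)"
    and unit_grade: "unit \<in> grade 0"
    and mult_grade: "\<lbrakk>a \<in> grade i; b \<in> grade j\<rbrakk> \<Longrightarrow> mult a b \<in> grade (i + j)"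
    and graded_commute: "\<lbrakk>a \<in> grade i; b \<in> grade j\<rbrakk> \<Longrightarrow> mult a b = sgn_pow (i * j) (mult b a)"

locale dg_algebra = graded_commutative_algebra scale mult unit grade
  for scale :: "'k::field \<Rightarrow> 'r::ab_group_add \<Rightarrow> 'r"
    and mult :: "'r \<Rightarrow> 'r \<Rightarrow> 'r"
    and unit :: 'r
    and grade :: "int \<Rightarrow> 'r set" +
  fixes diff :: "'r \<Rightarrow> 'r"
  assumes diff_linear: "Vector_Spaces.linear scale scale diff"
    and diff_grade: "a \<in> grade i \<Longrightarrow> diff a \<in> grade (i + 1)"
    and diff_diff: "diff (diff a) = 0"
    and diff_mult: "a \<in> grade i \<Longrightarrow> diff (mult a b) = mult (diff a) b + sgn_pow i (mult a (diff b))"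

locale dg_poisson_algebra = dg_algebra scale mult unit grade diff
  for scale :: "'k::field \<Rightarrow> 'r::ab_group_add \<Rightarrow> 'r"
    and mult :: "'r \<Rightarrow> 'r \<Rightarrow> 'r"
    and unit :: 'r
    and grade :: "int \<Rightarrow> 'r set"
    and diff :: "'r \<Rightarrow> 'r" +
  fixes bracket :: "'r \<Rightarrow> 'r \<Rightarrow> 'r"
  assumes bracket_linear_left: "Vector_Spaces.linear scale scale (\<lambda>a. bracket a b)"
    and bracket_linear_right: "Vector_Spaces.linear scale scale (\<lambda>b. bracket a b)"
    and bracket_grade: "\<lbrakk>a \<in> grade i; b \<in> grade j\<rbrakk> \<Longrightarrow> bracket a b \<in> grade (i + j)"
    and bracket_antisym:
      "\<lbrakk>a \<in> grade i; b \<in> grade j\<rbrakk> \<Longrightarrow> bracket a b = - sgn_pow (i * j) (bracket b a)"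
    and bracket_jacobi:
      "\<lbrakk>a \<in> grade i; b \<in> grade j\<rbrakk> \<Longrightarrow>
        bracket a (bracket b c) = bracket (bracket a b) c + sgn_pow (i * j) (bracket b (bracket a c))"
    and bracket_mult_right:
      "\<lbrakk>a \<in> grade i; b \<in> grade j\<rbrakk> \<Longrightarrow>
        bracket a (mult b c) = mult (bracket a b) c + sgn_pow (i * j) (mult b (bracket a c))"
    and bracket_mult_left:
      "\<lbrakk>b \<in> grade j; c \<in> grade l\<rbrakk> \<Longrightarrow>
        bracket (mult a b) c = mult a (bracket b c) + sgn_pow (j * l) (mult (bracket a c) b)"
    and diff_bracket:
      "a \<in> grade i \<Longrightarrow> diff (bracket a b) = bracket (diff a) b + sgn_pow i (bracket a (diff b))"


section \<open>The Koszul complex of one element\<close>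

text \<open>The pair \<open>(a, b)\<close> stands for \<open>a + b y\<close> in \<open>S[y] = S \<oplus> S y\<close>, with \<open>y\<^sup>2 = 0\<close> and \<open>y\<close> in
  degree \<open>-1\<close>.\<close>

type_synonym ('n, 'k) koszul = "('n, 'k) poly_ring \<times> ('n, 'k) poly_ring"

definition koszul_scale :: "'k::field \<Rightarrow> ('n, 'k) koszul \<Rightarrow> ('n, 'k) koszul" where
  "koszul_scale c u = (poly_scale c (fst u), poly_scale c (snd u))"

definition koszul_mult :: "('n, 'k::field) koszul \<Rightarrow> ('n, 'k) koszul \<Rightarrow> ('n, 'k) koszul" where
  "koszul_mult u v = (fst u * fst v, fst u * snd v + snd u * fst v)"

definition koszul_of :: "('n, 'k::field) poly_ring \<Rightarrow> ('n, 'k) koszul" where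
  "koszul_of a = (a, 0)"

definition koszul_y :: "('n, 'k::field) koszul" where
  "koszul_y = (0, 1)"

definition koszul_grade :: "int \<Rightarrow> ('n, 'k::field) koszul set" where
  "koszul_grade i = (if i = 0 then {(a, 0) | a. True} else if i = -1 then {(0, b) | b. True} else {0})"

definition koszul_diff :: "('n, 'k::field) poly_ring \<Rightarrow> ('n, 'k) koszul \<Rightarrow> ('n, 'k) koszul" where
  "koszul_diff f u = (snd u * f, 0)"

text \<open>A dg Poisson structure on the algebra \<open>S[y]\<close>: its \<open>k\<close>-algebra structure and grading are
  fixed, the differential and the bracket vary.\<close>

abbreviation koszul_dg_poisson ::
  "(('n, 'k::field) koszul \<Rightarrow> ('n, 'k) koszul) \<Rightarrow>
    (('n, 'k) koszul \<Rightarrow> ('n, 'k) koszul \<Rightarrow> ('n, 'k) koszul) \<Rightarrow> bool" where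
  "koszul_dg_poisson \<equiv>
    dg_poisson_algebra koszul_scale koszul_mult (koszul_of 1) koszul_grade"

definition koszul_generator_values ::
  "('n, 'k::field) poly_ring \<Rightarrow> ('n \<Rightarrow> 'n \<Rightarrow> ('n, 'k) poly_ring) \<Rightarrow> ('n \<Rightarrow> ('n, 'k) poly_ring) \<Rightarrow>
    (('n, 'k) koszul \<Rightarrow> ('n, 'k) koszul) \<Rightarrow>
    (('n, 'k) koszul \<Rightarrow> ('n, 'k) koszul \<Rightarrow> ('n, 'k) koszul) \<Rightarrow> bool" where
  "koszul_generator_values f \<Lambda> Z D B \<longleftrightarrow>
    D koszul_y = koszul_of f \<and>
    (\<forall>i j. B (koszul_of (var i)) (koszul_of (var j)) = koszul_of (\<Lambda> i j)) \<and>
    (\<forall>i. B (koszul_of (var i)) koszul_y = koszul_mult (koszul_of (Z i)) koszul_y)"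

end

theory Submission
  imports Defs
begin

text \<open>
  Since \<open>(f)\<close> is a Poisson ideal and \<open>S\<close> is a domain, every \<open>a \<in> S\<close> has exactly one cofactor
  \<open>\<zeta> a\<close> with \<open>{a, f} = \<zeta>(a) f\<close>; in particular \<open>Z\<^sub>i = \<zeta>(x\<^sub>i)\<close> is even unique in \<open>S\<close>. So the formula
  \<open>{a, y} = \<zeta>(a) y\<close> is forced by the generator values as soon as \<open>\<zeta>\<close> is known to be a derivation,
  and it defines the bracket
  \<open>{a + b y, c + d y} = {a, c} + ({a, d} + {b, c} + \<zeta>(a) d - \<zeta>(c) b) y\<close>.

  The identities that this bracket has to satisfy reduce to those of \<open>S\<close> and to identities for
  \<open>\<zeta>\<close>, which are all obtained by cancelling \<open>f\<close>. The Leibniz rule for \<open>\<zeta>\<close> comes from the one for \<open>{-, f}\<close>. The Jacobi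
  identity for \<open>a, b, f\<close> gives \<open>\<zeta>{a, b} = {a, \<zeta> b} - {b, \<zeta> a}\<close>, which makes \<open>S y\<close> a Poisson module
  and is the Jacobi identity for \<open>a, b, y\<close>. Finally \<open>{f, f} = 0\<close> gives \<open>\<zeta> f = 0\<close>; this is what makes
  the differential compatible with the vanishing of \<open>{b y, d y}\<close>, since
  \<open>{b f, d y} - {b y, d f} = 2 b d \<zeta>(f) y\<close>. These three facts are \<open>zeta_mult\<close>, \<open>zeta_bracket\<close> and
  \<open>zeta_f\<close>, and \<open>koszul_bracket_dg_poisson\<close> assembles them.

  Conversely, for any dg Poisson structure on \<open>S[y]\<close> the degrees force \<open>{a, c} \<in> S\<close>, \<open>{a, y} \<in> S y\<close> and
  \<open>{S y, S y} = 0\<close>. The first two are given by derivations of \<open>S\<close> in each argument from \<open>S\<close>, hence are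
  determined by the variables (\<open>poly_derivation_eqI\<close>), and antisymmetry and the Leibniz rule give the
  rest (\<open>koszul_dg_poisson_unique\<close>).
\<close>

section \<open>Polynomial rings are domains\<close>

lemma poly_mapping_sum_monomials:
  fixes p :: "'a \<Rightarrow>\<^sub>0 'b::comm_monoid_add"
  shows "p = (\<Sum>a\<in>Poly_Mapping.keys p. Poly_Mapping.single a (Poly_Mapping.lookup p a))"
proof (rule poly_mapping_eqI)
  fix k
  have "(\<Sum>a\<in>Poly_Mapping.keys p.
        Poly_Mapping.lookup (Poly_Mapping.single a (Poly_Mapping.lookup p a)) k) =
      (\<Sum>a\<in>Poly_Mapping.keys p. if a = k then Poly_Mapping.lookup p k else 0)"
    by (intro sum.cong) (auto simp: lookup_single)
  also have "\<dots> = Poly_Mapping.lookup p k"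
    by (simp add: in_keys_iff)
  finally show "Poly_Mapping.lookup p k =
      Poly_Mapping.lookup (\<Sum>a\<in>Poly_Mapping.keys p. Poly_Mapping.single a (Poly_Mapping.lookup p a)) k"
    by (simp add: lookup_sum)
qed

lemma lookup_mult_keys:
  fixes p q :: "'a::comm_monoid_add \<Rightarrow>\<^sub>0 'b::semiring_0"
  shows "Poly_Mapping.lookup (p * q) m =
    (\<Sum>(a, b)\<in>Poly_Mapping.keys p \<times> Poly_Mapping.keys q.
      if a + b = m then Poly_Mapping.lookup p a * Poly_Mapping.lookup q b else 0)"
proof -
  have "p * q = (\<Sum>a\<in>Poly_Mapping.keys p. Poly_Mapping.single a (Poly_Mapping.lookup p a)) *
      (\<Sum>b\<in>Poly_Mapping.keys q. Poly_Mapping.single b (Poly_Mapping.lookup q b))"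
    by (simp flip: poly_mapping_sum_monomials)
  also have "\<dots> = (\<Sum>(a, b)\<in>Poly_Mapping.keys p \<times> Poly_Mapping.keys q.
      Poly_Mapping.single (a + b) (Poly_Mapping.lookup p a * Poly_Mapping.lookup q b))"
    by (simp add: sum_product mult_single sum.cartesian_product)
  finally have "Poly_Mapping.lookup (p * q) m = Poly_Mapping.lookup (\<dots>) m"
    by simp
  also have "\<dots> = (\<Sum>(a, b)\<in>Poly_Mapping.keys p \<times> Poly_Mapping.keys q.
      Poly_Mapping.lookup
        (Poly_Mapping.single (a + b) (Poly_Mapping.lookup p a * Poly_Mapping.lookup q b)) m)"
    by (simp add: lookup_sum split_def)
  finally show ?thesis
    by (simp add: lookup_single when_def)
qed

text \<open>The leading monomials with respect to the order pulled back along \<open>w\<close> multiply to a monomial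
  that no other pair of monomials can produce, so its coefficient in the product is the product of
  the two leading coefficients.\<close>

lemma mult_nonzero_if_monomials_orderable:
  fixes p q :: "'a::comm_monoid_add \<Rightarrow>\<^sub>0 'b::semiring_no_zero_divisors"
    and w :: "'a \<Rightarrow> 'c::{ordered_cancel_comm_monoid_add, linorder}"
  assumes "inj w" and add: "\<And>a b. w (a + b) = w a + w b"
    and "p \<noteq> 0" and "q \<noteq> 0"
  shows "p * q \<noteq> 0"
proof -
  have top: "\<exists>m\<in>Poly_Mapping.keys r. \<forall>a\<in>Poly_Mapping.keys r. a \<noteq> m \<longrightarrow> w a < w m"
    if "r \<noteq> 0" for r :: "'a \<Rightarrow>\<^sub>0 'b"
  proof -
    have fin: "finite (w ` Poly_Mapping.keys r)" and ne: "w ` Poly_Mapping.keys r \<noteq> {}"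
      using that by auto
    obtain m where m: "m \<in> Poly_Mapping.keys r" "w m = Max (w ` Poly_Mapping.keys r)"
      using Max_in[OF fin ne] by (metis imageE)
    have "w a < w m" if "a \<in> Poly_Mapping.keys r" "a \<noteq> m" for a
      using that m fin \<open>inj w\<close> by (metis Max_ge image_eqI injD order_less_le)
    with m show ?thesis by blast
  qed
  obtain m where m: "m \<in> Poly_Mapping.keys p" "\<forall>a\<in>Poly_Mapping.keys p. a \<noteq> m \<longrightarrow> w a < w m"
    using top[OF \<open>p \<noteq> 0\<close>] by blast
  obtain n where n: "n \<in> Poly_Mapping.keys q" "\<forall>b\<in>Poly_Mapping.keys q. b \<noteq> n \<longrightarrow> w b < w n"
    using top[OF \<open>q \<noteq> 0\<close>] by blast
  have only: "a = m \<and> b = n"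
    if "a \<in> Poly_Mapping.keys p" "b \<in> Poly_Mapping.keys q" "a + b = m + n" for a b
  proof (rule ccontr)
    assume "\<not> (a = m \<and> b = n)"
    then have "w a + w b < w m + w n"
      using m n that by (metis add_le_less_mono add_less_le_mono order_less_imp_le order_refl)
    then show False
      using that(3) by (metis add order_less_irrefl)
  qed
  have "Poly_Mapping.lookup (p * q) (m + n) =
      (\<Sum>ab\<in>Poly_Mapping.keys p \<times> Poly_Mapping.keys q.
        if ab = (m, n) then Poly_Mapping.lookup p m * Poly_Mapping.lookup q n else 0)"
    unfolding lookup_mult_keys using only by (intro sum.cong) (auto split: if_splits)
  also have "\<dots> = Poly_Mapping.lookup p m * Poly_Mapping.lookup q n"
    using m n by (simp add: sum.delta)
  also have "\<dots> \<noteq> 0"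
    using m n by (simp add: in_keys_iff)
  finally show ?thesis
    by auto
qed

text \<open>The variables carry no order, but numbering them embeds the exponent vectors additively
  into \<open>nat \<Rightarrow>\<^sub>0 nat\<close>, which has a lexicographic order compatible with addition.\<close>

lemma poly_ring_mult_eq_0_iff:
  fixes p q :: "('n::finite, 'k::field) poly_ring"
  shows "p * q = 0 \<longleftrightarrow> p = 0 \<or> q = 0"
proof -
  obtain e :: "'n \<Rightarrow> nat" where e: "inj e"
    using finite_imp_inj_to_nat_seg[of "UNIV :: 'n set"] by auto
  define w :: "('n \<Rightarrow>\<^sub>0 nat) \<Rightarrow> (nat \<Rightarrow>\<^sub>0 nat)"
    where "w m = (\<Sum>i\<in>UNIV. Poly_Mapping.single (e i) (Poly_Mapping.lookup m i))" for m
  have w_add: "w (a + b) = w a + w b" for a b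
    by (simp add: w_def lookup_add single_add sum.distrib)
  have "Poly_Mapping.lookup (w m) (e j) = Poly_Mapping.lookup m j" for m j
    using e by (simp add: w_def lookup_sum lookup_single when_def inj_eq)
  then have "inj w"
    by (metis injI poly_mapping_eqI)
  then show ?thesis
    using mult_nonzero_if_monomials_orderable[of w, OF _ w_add]
    by (metis mult_zero_left mult_zero_right)
qed

lemma poly_ring_mult_right_cancel:
  fixes p q f :: "('n::finite, 'k::field) poly_ring"
  assumes "f \<noteq> 0"
  shows "p * f = q * f \<longleftrightarrow> p = q"
  using poly_ring_mult_eq_0_iff[of "p - q" f] assms by (simp add: left_diff_distrib)


section \<open>Derivations of the polynomial ring\<close>

lemma poly_ring_induct [case_names add mult scalar var]:
  fixes p :: "('n, 'k::field) poly_ring"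
  assumes add: "\<And>p q. P p \<Longrightarrow> P q \<Longrightarrow> P (p + q)"
    and mult: "\<And>p q. P p \<Longrightarrow> P q \<Longrightarrow> P (p * q)"
    and scalar: "\<And>c. P (poly_scale c 1)"
    and var: "\<And>i. P (var i)"
  shows "P p"
proof -
  have sum: "P (sum g A)" if "finite A" "\<And>a. a \<in> A \<Longrightarrow> P (g a)"
    for g :: "'b \<Rightarrow> ('n, 'k) poly_ring" and A
    using that
  proof (induction A rule: finite_induct)
    case empty
    then show ?case
      using scalar[of 0] by (simp add: poly_scale_def)
  qed (auto intro: add)
  have one: "P 1"
    using scalar[of 1] by (simp add: poly_scale_def)
  have power: "P (Poly_Mapping.single (Poly_Mapping.single i k) 1)" for i k
  proof (induction k)
    case 0
    then show ?case using one by simp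
  next
    case (Suc k)
    have "Poly_Mapping.single (Poly_Mapping.single i (Suc k)) 1 =
        var i * (Poly_Mapping.single (Poly_Mapping.single i k) 1 :: ('n, 'k) poly_ring)"
      by (simp add: var_def mult_single flip: single_add)
    with Suc show ?case by (simp add: mult var)
  qed
  have monomial_sum: "P (Poly_Mapping.single (\<Sum>i\<in>A. Poly_Mapping.single i (g i)) 1)"
    if "finite A" for A and g :: "'n \<Rightarrow> nat"
    using that
  proof (induction A rule: finite_induct)
    case empty
    then show ?case using one by simp
  next
    case (insert i A)
    then have "P (Poly_Mapping.single (Poly_Mapping.single i (g i)) 1 *
        Poly_Mapping.single (\<Sum>i\<in>A. Poly_Mapping.single i (g i)) 1)"
      by (intro mult power)
    with insert show ?case by (simp add: mult_single)
  qed
  have "P (Poly_Mapping.single m c)" for m c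
  proof -
    have "Poly_Mapping.single m c = poly_scale c 1 *
        Poly_Mapping.single (\<Sum>i\<in>Poly_Mapping.keys m. Poly_Mapping.single i
          (Poly_Mapping.lookup m i)) 1"
      by (simp add: poly_scale_def mult_single flip: poly_mapping_sum_monomials)
    then show ?thesis
      by (simp only:) (intro mult scalar monomial_sum finite_keys)
  qed
  then show ?thesis
    by (subst poly_mapping_sum_monomials) (intro sum, auto)
qed

definition poly_derivation :: "(('n, 'k::field) poly_ring \<Rightarrow> ('n, 'k) poly_ring) \<Rightarrow> bool" where
  "poly_derivation d \<longleftrightarrow> (\<forall>a b. d (a + b) = d a + d b) \<and>
    (\<forall>c a. d (poly_scale c a) = poly_scale c (d a)) \<and>
    (\<forall>a b. d (a * b) = d a * b + a * d b)"

text \<open>The set where two derivations agree is a subalgebra, because a derivation kills the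
  constants, and the variables generate the polynomial ring.\<close>

lemma poly_derivation_eqI:
  assumes d: "poly_derivation d" and e: "poly_derivation e"
    and var: "\<And>i. d (var i) = e (var i)"
  shows "d = e"
proof
  fix p
  have one: "d' 1 = 0" if "poly_derivation d'"
    for d' :: "('a, 'b::field) poly_ring \<Rightarrow> ('a, 'b) poly_ring"
  proof -
    have "d' (1 * 1) = d' 1 * 1 + 1 * d' 1"
      using that unfolding poly_derivation_def by blast
    then show ?thesis by simp
  qed
  show "d p = e p"
  proof (induction p rule: poly_ring_induct)
    case (scalar c)
    then show ?case
      using d e one[OF d] one[OF e] by (simp add: poly_derivation_def)
  qed (use d e var in \<open>simp_all add: poly_derivation_def\<close>)
qed


section \<open>Elementary identities in a Poisson algebra\<close>

context poisson_algebra
begin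

lemma bracket_add: "bracket (a + b) c = bracket a c + bracket b c"
    "bracket a (b + c) = bracket a b + bracket a c"
  and bracket_scale: "bracket (scale r a) b = scale r (bracket a b)"
    "bracket a (scale r b) = scale r (bracket a b)"
  using bracket_linear_left bracket_linear_right unfolding Vector_Spaces.linear_iff by blast+

lemma bracket_zero: "bracket 0 a = 0" "bracket a 0 = 0"
  using bracket_add(1)[of 0 0 a] bracket_add(2)[of a 0 0] by auto

lemma bracket_minus: "bracket (- a) b = - bracket a b" "bracket a (- b) = - bracket a b"
  using bracket_add(1)[of a "- a" b] bracket_add(2)[of a b "- b"]
  by (simp_all add: bracket_zero eq_neg_iff_add_eq_0 add.commute)

lemma bracket_diff: "bracket (a - b) c = bracket a c - bracket b c"
    "bracket a (b - c) = bracket a b - bracket a c"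
  using bracket_add(1)[of a "- b" c] bracket_add(2)[of a b "- c"] by (simp_all add: bracket_minus)

lemma bracket_skew: "bracket a b = - bracket b a"
proof -
  have "bracket a b + bracket b a = 0"
    using bracket_self[of "a + b"] unfolding bracket_add
    by (simp add: bracket_self add.commute)
  then show ?thesis
    by (simp only: eq_neg_iff_add_eq_0)
qed

lemma leibniz_left: "bracket (a * b) c = a * bracket b c + bracket a c * b"
proof -
  have "bracket (a * b) c = - (bracket c a * b + a * bracket c b)"
    by (subst bracket_skew) (simp add: leibniz)
  then show ?thesis
    using bracket_skew[of a c] bracket_skew[of b c] by (simp add: algebra_simps)
qed

lemma jacobi_derivation:
  "bracket a (bracket b c) = bracket (bracket a b) c + bracket b (bracket a c)"
proof -
  have "bracket b (bracket c a) = - bracket b (bracket a c)"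
    using bracket_skew[of c a] by (simp add: bracket_minus)
  moreover have "bracket c (bracket a b) = - bracket (bracket a b) c"
    by (rule bracket_skew)
  ultimately show ?thesis
    using jacobi[of a b c] by (simp only:) (simp add: algebra_simps)
qed

end


section \<open>The logarithmic derivative along a Poisson element\<close>

text \<open>The cofactor \<open>zeta a\<close> is formally \<open>{a, f} / f = {a, log f}\<close>. As \<open>f\<close> can be
  cancelled, \<open>bracket_f\<close> determines \<open>zeta\<close>, and identities for \<open>zeta\<close> may be checked after
  multiplication by \<open>f\<close>.\<close>

locale koszul_poisson = poisson_algebra poly_scale bracket
  for bracket :: "('n::finite, 'k::field) poly_ring \<Rightarrow> ('n, 'k) poly_ring \<Rightarrow> ('n, 'k) poly_ring" +
  fixes f :: "('n, 'k) poly_ring" and zeta :: "('n, 'k) poly_ring \<Rightarrow> ('n, 'k) poly_ring"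
  assumes f_nonzero: "f \<noteq> 0"
    and bracket_f: "bracket a f = zeta a * f"
begin

lemma zeta_eqI: "bracket a f = z * f \<Longrightarrow> zeta a = z"
  using f_nonzero by (simp add: bracket_f poly_ring_mult_right_cancel)

lemma zeta_add: "zeta (a + b) = zeta a + zeta b"
  by (rule zeta_eqI, subst bracket_add) (simp add: bracket_f algebra_simps)

lemma zeta_scale: "zeta (poly_scale r a) = poly_scale r (zeta a)"
  by (rule zeta_eqI, subst bracket_scale) (simp add: bracket_f scale_mult)

lemma zeta_mult: "zeta (a * b) = zeta a * b + a * zeta b"
  by (rule zeta_eqI, subst leibniz_left) (simp add: bracket_f algebra_simps)

lemma zeta_f: "zeta f = 0"
  by (rule zeta_eqI) (simp add: bracket_self)

lemma zeta_zero: "zeta 0 = 0"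
  by (rule zeta_eqI) (simp add: bracket_zero)

text \<open>This is the Jacobi identity for \<open>a\<close>, \<open>b\<close>, \<open>f\<close>, divided by \<open>f\<close>: in
  \<open>{a, {b, f}} = {a, \<zeta> b} f + \<zeta>(a) \<zeta>(b) f\<close> the last term is symmetric in \<open>a\<close> and \<open>b\<close>. It expresses
  that \<open>{a, y} = \<zeta>(a) y\<close> defines an action of the Lie algebra \<open>S\<close> on \<open>S y\<close>.\<close>

lemma zeta_bracket: "zeta (bracket a b) = bracket a (zeta b) - bracket b (zeta a)"
proof (rule zeta_eqI)
  have "bracket (bracket a b) f = bracket a (bracket b f) - bracket b (bracket a f)"
    using jacobi_derivation[of a b f] by simp
  also have "\<dots> = (bracket a (zeta b) - bracket b (zeta a)) * f"
    by (simp add: bracket_f leibniz algebra_simps)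
  finally show "bracket (bracket a b) f = \<dots>" .
qed

end


section \<open>The Koszul algebra as a dg algebra\<close>

lemma poly_scale_simps:
  "poly_scale c (p + q) = poly_scale c p + poly_scale c q"
  "poly_scale (c + d) p = poly_scale c p + poly_scale d p"
  "poly_scale c (poly_scale d p) = poly_scale (c * d) p"
  "poly_scale 1 p = p"
  "poly_scale c p * q = poly_scale c (p * q)"
  "p * poly_scale c q = poly_scale c (p * q)"
  "poly_scale c 0 = 0"
  by (simp_all add: poly_scale_def single_add algebra_simps mult_single flip: mult.assoc)

lemma poly_scale_minus: "poly_scale c (p - q) = poly_scale c p - poly_scale c q"
  by (simp add: poly_scale_def algebra_simps)

lemma koszul_vector_space: "vector_space koszul_scale"
  by unfold_locales (auto simp: koszul_scale_def poly_scale_simps)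

lemma koszul_linearI:
  fixes F :: "('n, 'k::field) koszul \<Rightarrow> ('n, 'k) koszul"
  assumes "\<And>u v. F (u + v) = F u + F v" and "\<And>c u. F (koszul_scale c u) = koszul_scale c (F u)"
  shows "Vector_Spaces.linear koszul_scale koszul_scale F"
  using assms koszul_vector_space by (simp add: Vector_Spaces.linear_iff)

lemma koszul_grade_cases:
  assumes "u \<in> koszul_grade i"
  obtains (even) a where "i = 0" and "u = (a, 0)"
    | (odd) b where "i = -1" and "u = (0, b)"
    | (zero) "u = 0"
  using assms by (auto simp: koszul_grade_def split: if_splits)

lemma koszul_grade_homogeneous:
  "(a, 0) \<in> koszul_grade 0" "(0, b) \<in> koszul_grade (-1)" "0 \<in> koszul_grade i"
  "(0, 0) \<in> koszul_grade i"
  by (auto simp: koszul_grade_def zero_prod_def)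

text \<open>A family of homogeneous elements is supported in the degrees \<open>0\<close> and \<open>-1\<close>, so its sum is the
  pair of these two components, from which the family can be read off.\<close>

lemma koszul_grade_direct_sum:
  fixes u :: "('n, 'k::field) koszul"
  shows "\<exists>!c. (\<forall>i. c i \<in> koszul_grade i) \<and> finite {i. c i \<noteq> 0} \<and> u = (\<Sum>i | c i \<noteq> 0. c i)"
proof -
  have two: "finite {i. c i \<noteq> 0} \<and> (\<Sum>i | c i \<noteq> 0. c i) = (fst (c 0), snd (c (-1)))"
    if c: "\<forall>i. c i \<in> koszul_grade i" for c :: "int \<Rightarrow> ('n, 'k) koszul"
  proof -
    have sub: "{i. c i \<noteq> 0} \<subseteq> {0, -1}"
      using c by (auto simp: koszul_grade_def split: if_splits)
    then have "(\<Sum>i | c i \<noteq> 0. c i) = (\<Sum>i\<in>{0, -1}. c i)"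
      by (intro sum.mono_neutral_left) auto
    also have "\<dots> = (fst (c 0), snd (c (-1)))"
      using c[THEN spec, of 0] c[THEN spec, of "-1"] by (auto simp: koszul_grade_def)
    finally show ?thesis
      using sub finite_subset by auto
  qed
  define c0 :: "int \<Rightarrow> ('n, 'k) koszul"
    where "c0 i = (if i = 0 then (fst u, 0) else if i = -1 then (0, snd u) else 0)" for i
  have c0: "\<forall>i. c0 i \<in> koszul_grade i"
    by (simp add: c0_def koszul_grade_def)
  show ?thesis
  proof (rule ex1I[of _ c0])
    show "(\<forall>i. c0 i \<in> koszul_grade i) \<and> finite {i. c0 i \<noteq> 0} \<and> u = (\<Sum>i | c0 i \<noteq> 0. c0 i)"
      using c0 two[OF c0] by (simp add: c0_def)
  next
    fix c :: "int \<Rightarrow> ('n, 'k) koszul"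
    assume c: "(\<forall>i. c i \<in> koszul_grade i) \<and> finite {i. c i \<noteq> 0} \<and> u = (\<Sum>i | c i \<noteq> 0. c i)"
    then have "u = (fst (c 0), snd (c (-1)))"
      using two by metis
    moreover have "c i \<in> koszul_grade i" for i
      using c by blast
    from this[of 0] this[of "-1"] have "snd (c 0) = 0" "fst (c (-1)) = 0"
      by (auto simp: koszul_grade_def)
    moreover have "c i = 0" if "i \<noteq> 0" "i \<noteq> -1" for i
      using c that by (metis koszul_grade_def singletonD)
    ultimately show "c = c0"
      by (auto simp: c0_def fun_eq_iff prod_eq_iff)
  qed
qed

lemma koszul_graded_commutative_algebra:
  "graded_commutative_algebra koszul_scale
    (koszul_mult :: ('n, 'k::field) koszul \<Rightarrow> _) (koszul_of 1) koszul_grade"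
proof -
  interpret vector_space "koszul_scale :: 'k \<Rightarrow> ('n, 'k) koszul \<Rightarrow> _"
    by (rule koszul_vector_space)
  show "graded_commutative_algebra koszul_scale
      (koszul_mult :: ('n, 'k) koszul \<Rightarrow> _) (koszul_of 1) koszul_grade"
  proof (intro graded_commutative_algebra.intro graded_commutative_algebra_axioms.intro
      koszul_vector_space)
    fix a b c :: "('n, 'k) koszul" and i j :: int
    show "Vector_Spaces.linear koszul_scale koszul_scale (\<lambda>a. koszul_mult a b)"
      by (rule koszul_linearI)
        (auto simp: koszul_mult_def koszul_scale_def poly_scale_simps algebra_simps)
    show "Vector_Spaces.linear koszul_scale koszul_scale (\<lambda>b. koszul_mult a b)"
      by (rule koszul_linearI)
        (auto simp: koszul_mult_def koszul_scale_def poly_scale_simps algebra_simps)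
    show "koszul_mult (koszul_mult a b) c = koszul_mult a (koszul_mult b c)"
      by (simp add: koszul_mult_def algebra_simps)
    show "koszul_mult (koszul_of 1) a = a" "koszul_mult a (koszul_of 1) = a"
      by (simp_all add: koszul_mult_def koszul_of_def)
    show "subspace (koszul_grade i :: ('n, 'k) koszul set)"
      by (auto simp: subspace_def koszul_grade_def koszul_scale_def poly_scale_simps zero_prod_def)
    show "\<exists>!c. (\<forall>i. c i \<in> koszul_grade i) \<and> finite {i. c i \<noteq> 0} \<and> a = (\<Sum>i | c i \<noteq> 0. c i)"
      by (rule koszul_grade_direct_sum)
    show "koszul_of 1 \<in> (koszul_grade 0 :: ('n, 'k) koszul set)"
      by (simp add: koszul_of_def koszul_grade_homogeneous)
    assume "a \<in> koszul_grade i" "b \<in> koszul_grade j"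
    then show "koszul_mult a b \<in> koszul_grade (i + j)"
      and "koszul_mult a b = sgn_pow (i * j) (koszul_mult b a)"
      by (auto elim!: koszul_grade_cases
          simp: koszul_mult_def koszul_grade_homogeneous sgn_pow_def zero_prod_def)
  qed
qed

lemma koszul_dg_algebra:
  fixes f :: "('n, 'k::field) poly_ring"
  shows
  "dg_algebra koszul_scale koszul_mult (koszul_of 1) koszul_grade (koszul_diff f)"
proof (intro dg_algebra.intro dg_algebra_axioms.intro koszul_graded_commutative_algebra)
  fix a b :: "('n, 'k) koszul" and i :: int
  show "Vector_Spaces.linear koszul_scale koszul_scale (koszul_diff f)"
    by (rule koszul_linearI)
      (auto simp: koszul_diff_def koszul_scale_def poly_scale_simps algebra_simps)
  show "koszul_diff f (koszul_diff f a) = 0"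
    by (simp add: koszul_diff_def zero_prod_def)
  assume "a \<in> koszul_grade i"
  then show "koszul_diff f a \<in> koszul_grade (i + 1)"
    and "koszul_diff f (koszul_mult a b) =
      koszul_mult (koszul_diff f a) b + sgn_pow i (koszul_mult a (koszul_diff f b))"
    by (auto elim!: koszul_grade_cases
        simp: koszul_mult_def koszul_diff_def koszul_grade_homogeneous sgn_pow_def zero_prod_def
          algebra_simps)
qed


section \<open>The bracket on the Koszul algebra\<close>

text \<open>The last two terms come from \<open>{a, y} = \<zeta>(a) y\<close> and \<open>{y, c} = - \<zeta>(c) y\<close>; there is no term
  in \<open>snd u * snd v\<close> because \<open>{y, y}\<close> has degree \<open>-2\<close>.\<close>

definition koszul_bracket ::
  "(('n, 'k::field) poly_ring \<Rightarrow> ('n, 'k) poly_ring \<Rightarrow> ('n, 'k) poly_ring) \<Rightarrow>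
    (('n, 'k) poly_ring \<Rightarrow> ('n, 'k) poly_ring) \<Rightarrow>
    ('n, 'k) koszul \<Rightarrow> ('n, 'k) koszul \<Rightarrow> ('n, 'k) koszul" where
  "koszul_bracket br \<zeta> u v =
    (br (fst u) (fst v),
     br (fst u) (snd v) + br (snd u) (fst v) + \<zeta> (fst u) * snd v - \<zeta> (fst v) * snd u)"

context koszul_poisson
begin

lemmas koszul_bracket_simps = koszul_bracket_def koszul_mult_def koszul_diff_def sgn_pow_def
  zero_prod_def bracket_add bracket_minus bracket_diff bracket_zero leibniz leibniz_left
  zeta_add zeta_mult zeta_zero zeta_bracket zeta_f

text \<open>If \<open>a\<close> and \<open>b\<close> both lie in \<open>S y\<close>, all terms vanish by degree. Otherwise the part without
  \<open>\<zeta>\<close> is the Jacobi identity of \<open>S\<close>, and the part with \<open>\<zeta>\<close> cancels by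
  \<open>zeta_bracket\<close> and the Leibniz rules.\<close>

lemma koszul_bracket_jacobi:
  fixes a b c :: "('n, 'k) koszul"
  defines "B \<equiv> koszul_bracket bracket zeta"
  assumes a: "a \<in> koszul_grade i" and b: "b \<in> koszul_grade j"
  shows "B a (B b c) = B (B a b) c + sgn_pow (i * j) (B b (B a c))"
proof -
  obtain p q where c: "c = (p, q)"
    by (cases c)
  have ev_ev: "B (a, 0) (B (b, 0) c) = B (B (a, 0) (b, 0)) c + B (b, 0) (B (a, 0) c)" for a b
    unfolding B_def c
    using jacobi_derivation[of a b p] jacobi_derivation[of a b q]
    by (simp add: koszul_bracket_simps algebra_simps)
  have ev_odd: "B (a, 0) (B (0, b) c) = B (B (a, 0) (0, b)) c + B (0, b) (B (a, 0) c)" for a b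
    unfolding B_def c
    using jacobi_derivation[of a b p] bracket_skew[of p "zeta a"]
    by (simp add: koszul_bracket_simps algebra_simps)
  have odd_ev: "B (0, a) (B (b, 0) c) = B (B (0, a) (b, 0)) c + B (b, 0) (B (0, a) c)" for a b
    unfolding B_def c
    using jacobi_derivation[of a b p] bracket_skew[of p "zeta b"] bracket_skew[of b a]
    by (simp add: koszul_bracket_simps algebra_simps)
  have odd_odd: "B (0, a) (B (0, b) c) = 0" "B (B (0, a) (0, b)) c = 0" for a b
    unfolding B_def c by (simp_all add: koszul_bracket_simps)
  have zero: "B 0 u = 0" "B u 0 = 0" for u
    unfolding B_def by (simp_all add: koszul_bracket_simps)
  show ?thesis
    using a b
    by (elim koszul_grade_cases) (simp_all add: odd_odd zero sgn_pow_def ev_ev[symmetric]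
        ev_odd[symmetric] odd_ev[symmetric])
qed

lemma koszul_bracket_dg_poisson: "koszul_dg_poisson (koszul_diff f) (koszul_bracket bracket zeta)"
proof -
  let ?B = "koszul_bracket bracket zeta"
  show ?thesis
  proof (intro dg_poisson_algebra.intro dg_poisson_algebra_axioms.intro koszul_dg_algebra)
    fix a b c :: "('n, 'k) koszul" and i j l :: int
    show "Vector_Spaces.linear koszul_scale koszul_scale (\<lambda>a. ?B a b)"
      by (rule koszul_linearI)
        (simp_all add: koszul_bracket_def koszul_scale_def bracket_add bracket_scale zeta_add
          zeta_scale poly_scale_simps poly_scale_minus algebra_simps)
    show "Vector_Spaces.linear koszul_scale koszul_scale (\<lambda>b. ?B a b)"
      by (rule koszul_linearI)
        (simp_all add: koszul_bracket_def koszul_scale_def bracket_add bracket_scale zeta_add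
          zeta_scale poly_scale_simps poly_scale_minus algebra_simps)
    show "?B a b \<in> koszul_grade (i + j)" if "a \<in> koszul_grade i" "b \<in> koszul_grade j"
      using that by (auto elim!: koszul_grade_cases
          simp: koszul_bracket_def koszul_grade_homogeneous bracket_zero zeta_zero zero_prod_def)
    show "?B a b = - sgn_pow (i * j) (?B b a)" if "a \<in> koszul_grade i" "b \<in> koszul_grade j"
      using that
      by (auto elim!: koszul_grade_cases
          simp: koszul_bracket_def sgn_pow_def bracket_zero zeta_zero zero_prod_def
          intro: bracket_skew)
    show "?B a (?B b c) = ?B (?B a b) c + sgn_pow (i * j) (?B b (?B a c))"
      if "a \<in> koszul_grade i" "b \<in> koszul_grade j"
      using that by (rule koszul_bracket_jacobi)
    show "?B a (koszul_mult b c) =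
        koszul_mult (?B a b) c + sgn_pow (i * j) (koszul_mult b (?B a c))"
      if "a \<in> koszul_grade i" "b \<in> koszul_grade j"
      using that
      by (auto elim!: koszul_grade_cases simp: koszul_bracket_simps algebra_simps)
    show "?B (koszul_mult a b) c =
        koszul_mult a (?B b c) + sgn_pow (j * l) (koszul_mult (?B a c) b)"
      if "b \<in> koszul_grade j" "c \<in> koszul_grade l"
      using that
      by (auto elim!: koszul_grade_cases simp: koszul_bracket_simps algebra_simps)
    show "koszul_diff f (?B a b) =
        ?B (koszul_diff f a) b + sgn_pow i (?B a (koszul_diff f b))"
      if "a \<in> koszul_grade i"
      using that
    proof (cases rule: koszul_grade_cases)
      case (even p)
      then show ?thesis
        by (simp add: koszul_bracket_simps bracket_f algebra_simps)
    next
      case (odd p)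
      then show ?thesis
        \<comment> \<open>For \<open>a = p y\<close> and \<open>b = c + d y\<close>, the \<open>y\<close>-coefficient on the right is \<open>2 p d \<zeta>(f)\<close>, which is
          \<open>0\<close> by \<open>zeta_f\<close>.\<close>
        using bracket_skew[of f "fst b"] bracket_skew[of f "snd b"]
        by (simp add: koszul_bracket_simps bracket_f algebra_simps)
    next
      case zero
      then show ?thesis
        by (simp add: koszul_bracket_simps)
    qed
  qed
qed

lemma poly_derivation_bracket:
  "poly_derivation (bracket a)" "poly_derivation (\<lambda>a. bracket a b)"
  by (simp_all add: poly_derivation_def bracket_add bracket_scale leibniz leibniz_left add.commute)

lemma poly_derivation_zeta: "poly_derivation zeta"
  by (simp add: poly_derivation_def zeta_add zeta_scale zeta_mult)

text \<open>Degrees leave only \<open>D y\<close>, \<open>{a, c} \<in> S\<close> and \<open>{a, y} \<in> S y\<close> to be determined; the first is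
  prescribed, and the other two are derivations of \<open>S\<close> in the arguments from \<open>S\<close>.\<close>

lemma koszul_dg_poisson_unique:
  assumes dgP: "koszul_dg_poisson D B"
    and gen: "koszul_generator_values f (\<lambda>i j. bracket (var i) (var j)) (\<lambda>i. zeta (var i)) D B"
  shows "D = koszul_diff f" and "B = koszul_bracket bracket zeta"
proof -
  interpret P: dg_poisson_algebra koszul_scale koszul_mult "koszul_of 1" koszul_grade D B
    by (rule dgP)
  have D_add: "D (u + v) = D u + D v" for u v
    using P.diff_linear unfolding Vector_Spaces.linear_iff by blast
  have B_add: "B (u + v) w = B u w + B v w" "B w (u + v) = B w u + B w v" for u v w
    using P.bracket_linear_left P.bracket_linear_right unfolding Vector_Spaces.linear_iff
    by blast+
  have B_scale: "B (koszul_scale r u) w = koszul_scale r (B u w)"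
    "B w (koszul_scale r u) = koszul_scale r (B w u)" for r u w
    using P.bracket_linear_left P.bracket_linear_right unfolding Vector_Spaces.linear_iff
    by blast+
  have times_y: "(0, b) = koszul_mult (b, 0) koszul_y" for b :: "('n, 'k) poly_ring"
    by (simp add: koszul_mult_def koszul_y_def)
  have y: "koszul_y \<in> (koszul_grade (-1) :: ('n, 'k) koszul set)"
    by (simp add: koszul_y_def koszul_grade_homogeneous)
  note ev = koszul_grade_homogeneous(1) and odd = koszul_grade_homogeneous(2)
  note gens = gen[unfolded koszul_generator_values_def koszul_of_def]

  have D_even: "D (a, 0) = 0" for a
    using P.diff_grade[OF ev[of a]] by (simp add: koszul_grade_def)
  have D_odd: "D (0, b) = (b * f, 0)" for b
    using P.diff_mult[OF ev[of b], of koszul_y] gens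
    by (simp add: D_even flip: times_y) (simp add: koszul_mult_def sgn_pow_def)
  show "D = koszul_diff f"
  proof
    fix u
    show "D u = koszul_diff f u"
      using D_add[of "(fst u, 0)" "(0, snd u)"]
      by (simp add: D_even D_odd koszul_diff_def)
  qed

  \<comment> \<open>The restriction of the bracket to \<open>S\<close> is a derivation in each argument; agreement on the
    variables is propagated first through the second argument, then through the first.\<close>
  define \<beta> where "\<beta> a c = fst (B (a, 0) (c, 0))" for a c
  have B_even: "B (a, 0) (c, 0) = (\<beta> a c, 0)" for a c
    using P.bracket_grade[OF ev[of a] ev[of c]] by (auto simp: \<beta>_def koszul_grade_def)
  have "poly_derivation (\<beta> a)" for a
    unfolding poly_derivation_def
  proof (intro conjI allI)
    fix b c r
    show "\<beta> a (b + c) = \<beta> a b + \<beta> a c"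
      using B_add(2)[of "(a, 0)" "(b, 0)" "(c, 0)"] by (simp add: B_even)
    show "\<beta> a (poly_scale r b) = poly_scale r (\<beta> a b)"
      using B_scale(2)[of "(a, 0)" r "(b, 0)"]
      by (simp add: B_even koszul_scale_def poly_scale_simps)
    show "\<beta> a (b * c) = \<beta> a b * c + b * \<beta> a c"
      using P.bracket_mult_right[OF ev[of a] ev[of b], of "(c, 0)"]
      by (simp add: B_even koszul_mult_def sgn_pow_def)
  qed
  moreover have left: "poly_derivation (\<lambda>a. \<beta> a c)" for c
    unfolding poly_derivation_def
  proof (intro conjI allI)
    fix a b r
    show "\<beta> (a + b) c = \<beta> a c + \<beta> b c"
      using B_add(1)[of "(a, 0)" "(b, 0)" "(c, 0)"] by (simp add: B_even)
    show "\<beta> (poly_scale r a) c = poly_scale r (\<beta> a c)"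
      using B_scale(1)[of r "(a, 0)" "(c, 0)"]
      by (simp add: B_even koszul_scale_def poly_scale_simps)
    show "\<beta> (a * b) c = \<beta> a c * b + a * \<beta> b c"
      using P.bracket_mult_left[OF ev[of b] ev[of c], of "(a, 0)"]
      by (simp add: B_even koszul_mult_def sgn_pow_def)
  qed
  ultimately have "\<beta> (var i) = bracket (var i)" for i
    using gens by (intro poly_derivation_eqI poly_derivation_bracket) (simp_all add: \<beta>_def)
  then have "(\<lambda>a. \<beta> a c) = (\<lambda>a. bracket a c)" for c
    by (intro poly_derivation_eqI poly_derivation_bracket left) simp
  then have \<beta>: "\<beta> a c = bracket a c" for a c
    by meson

  \<comment> \<open>The cofactor of \<open>{a, y}\<close> is a derivation in \<open>a\<close>, and so is \<open>zeta\<close>.\<close>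
  define \<eta> where "\<eta> a = snd (B (a, 0) koszul_y)" for a
  have B_y: "B (a, 0) koszul_y = (0, \<eta> a)" for a
    using P.bracket_grade[OF ev[of a] y] by (auto simp: \<eta>_def koszul_grade_def)
  have "poly_derivation \<eta>"
    unfolding poly_derivation_def
  proof (intro conjI allI)
    fix a b r
    show "\<eta> (a + b) = \<eta> a + \<eta> b"
      using B_add(1)[of "(a, 0)" "(b, 0)" koszul_y] by (simp add: B_y)
    show "\<eta> (poly_scale r a) = poly_scale r (\<eta> a)"
      using B_scale(1)[of r "(a, 0)" koszul_y]
      by (simp add: B_y koszul_scale_def poly_scale_simps)
    show "\<eta> (a * b) = \<eta> a * b + a * \<eta> b"
      using P.bracket_mult_left[OF ev[of b] y, of "(a, 0)"]
      by (simp add: B_y koszul_mult_def sgn_pow_def)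
  qed
  then have \<eta>: "\<eta> = zeta"
    using gens by (intro poly_derivation_eqI poly_derivation_zeta)
      (simp_all add: \<eta>_def koszul_mult_def koszul_y_def)

  have B_even_odd: "B (a, 0) (0, d) = (0, bracket a d + zeta a * d)" for a d
    using P.bracket_mult_right[OF ev[of a] ev[of d], of koszul_y]
    by (simp add: B_even B_y \<beta> \<eta> flip: times_y)
      (simp add: koszul_mult_def koszul_y_def sgn_pow_def)
  have B_odd_even: "B (0, b) (c, 0) = (0, bracket b c - zeta c * b)" for b c
    using P.bracket_antisym[OF odd[of b] ev[of c]] bracket_skew[of c b]
    by (simp add: B_even_odd sgn_pow_def)
  have B_odd_odd: "B (0, b) (0, d) = 0" for b d
    using P.bracket_grade[OF odd[of b] odd[of d]] by (simp add: koszul_grade_def)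
  show "B = koszul_bracket bracket zeta"
  proof (intro ext)
    fix u v
    have "B u v = B ((fst u, 0) + (0, snd u)) ((fst v, 0) + (0, snd v))"
      by simp
    also have "\<dots> = koszul_bracket bracket zeta u v"
      unfolding B_add by (simp add: B_even B_even_odd B_odd_even B_odd_odd \<beta> koszul_bracket_def)
    finally show "B u v = koszul_bracket bracket zeta u v" .
  qed
qed

lemma koszul_bracket_generator_values:
  "koszul_generator_values f (\<lambda>i j. bracket (var i) (var j)) (\<lambda>i. zeta (var i))
    (koszul_diff f) (koszul_bracket bracket zeta)"
proof -
  have "bracket a 1 = 0" for a
    using leibniz[of a 1 1] by simp
  then show ?thesis
    by (simp add: koszul_generator_values_def koszul_bracket_def koszul_diff_def koszul_of_def
        koszul_y_def koszul_mult_def bracket_zero zeta_zero)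
qed

end


section \<open>Principal Poisson ideals\<close>

theorem theorem3p8:
  fixes bracket :: "('n::finite, 'k::field_char_0) poly_ring \<Rightarrow> ('n, 'k) poly_ring \<Rightarrow> ('n, 'k) poly_ring"
    and \<Lambda> :: "'n \<Rightarrow> 'n \<Rightarrow> ('n, 'k) poly_ring"
    and f :: "('n, 'k) poly_ring"
    and I :: "('n, 'k) poly_ring set"
  assumes "poisson_algebra poly_scale bracket"
    and "\<And>i j. \<Lambda> i j = bracket (var i) (var j)"
    and "I = principal_ideal f"
    and "poisson_ideal bracket I"
    and "f \<noteq> 0"
  shows "(\<forall>i. (\<exists>z. bracket (var i) f = z * f) \<and>
            (\<forall>z z'. bracket (var i) f = z * f \<and> bracket (var i) f = z' * f \<longrightarrow> z - z' \<in> I)) \<and>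
    (\<forall>Z. (\<forall>i. bracket (var i) f = Z i * f) \<longrightarrow>
      (\<exists>B. koszul_dg_poisson (koszul_diff f) B \<and>
           koszul_generator_values f \<Lambda> Z (koszul_diff f) B \<and>
           (\<forall>D' B'. koszul_dg_poisson D' B' \<and> koszul_generator_values f \<Lambda> Z D' B' \<longrightarrow>
              D' = koszul_diff f \<and> B' = B)))"
proof -
  interpret poisson_algebra poly_scale bracket
    by (rule assms(1))
  have "f \<in> I"
    using assms(3) by (auto simp: principal_ideal_def intro: exI[of _ 1])
  have "\<exists>z. bracket a f = z * f" for a
  proof -
    obtain z where "bracket f a = z * f"
      using assms(3,4) \<open>f \<in> I\<close> unfolding poisson_ideal_def principal_ideal_def by blast
    then have "bracket a f = (- z) * f"
      using bracket_skew[of a f] by simp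
    then show ?thesis ..
  qed
  then obtain zeta where zeta: "\<And>a. bracket a f = zeta a * f"
    by metis
  interpret koszul_poisson bracket f zeta
    by unfold_locales (use zeta assms(5) in auto)
  have unique: "z = z'" if "bracket a f = z * f" "bracket a f = z' * f" for a z z'
    using that zeta_eqI by metis
  have "0 \<in> I"
    using assms(4) by (simp add: poisson_ideal_def is_ideal_def)
  have \<Lambda>: "\<Lambda> = (\<lambda>i j. bracket (var i) (var j))"
    using assms(2) by blast
  have Z: "Z = (\<lambda>i. zeta (var i))" if "\<forall>i. bracket (var i) f = Z i * f" for Z
    using that zeta_eqI by metis
  show ?thesis
  proof (intro conjI allI impI)
    show "\<exists>z. bracket (var i) f = z * f" for i
      using zeta by blast
    show "z - z' \<in> I" if "bracket (var i) f = z * f \<and> bracket (var i) f = z' * f" for i z z'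
      using that unique \<open>0 \<in> I\<close> by (metis diff_self)
    show "\<exists>B. koszul_dg_poisson (koszul_diff f) B \<and>
        koszul_generator_values f \<Lambda> Z (koszul_diff f) B \<and>
        (\<forall>D' B'. koszul_dg_poisson D' B' \<and> koszul_generator_values f \<Lambda> Z D' B' \<longrightarrow>
          D' = koszul_diff f \<and> B' = B)" if "\<forall>i. bracket (var i) f = Z i * f" for Z
      unfolding \<Lambda> Z[OF that]
      using koszul_bracket_dg_poisson koszul_bracket_generator_values koszul_dg_poisson_unique
      by blast
  qed
qed

end
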